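(* Let $K$ be a field and let $G$ be a finite simple graph on the vertex set $[n]$. Suppose that all cycles of $G$ have length $\ge7$ (which for example is the case when $G$ is a forest). Then $G$ is rigid if and only if each edge of $G$ is a branch.
   Context: Let $S=K[x_1,\ldots,x_n]$. The edge ideal $I(G)\subseteq S$ is generated by the products $x_ix_j$ with $\{i,j\}\in E(G)$. For an ideal $I\subseteq S$, $T^1(S/I)$ is the cokernel of $\delta^*:\mathrm{Der}_K(S)\to\mathrm{Hom}_S(I,S/I)$, $\delta^*(\partial)(f)=\partial f+I$. The graph $G$ is called rigid if $T^1(S/I(G))=0$. A vertex is free if it has degree $1$. An edge is a leaf if it contains a free vertex. An edge $e$ of $G$ is a branch if there exists a leaf $e'\neq e$ with $e\cap e'\neq\emptyset$. *)

theory Defs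
  imports
    "HOL-Library.Poly_Mapping"
    "HOL-Algebra.QuotRing"
    "HOL-Algebra.Module"
    "HOL-Algebra.Elementary_Groups"
begin

section \<open>Finite simple graphs\<close>

definition simple_graph :: "'v set \<Rightarrow> 'v set set \<Rightarrow> bool" where
  "simple_graph V E \<longleftrightarrow> finite V \<and> (\<forall>e\<in>E. e \<subseteq> V \<and> card e = 2)"

text \<open>A cycle is given by the list of its (at least three) distinct vertices in cyclic order;
  its length, i.e. its number of edges, is the length of that list.\<close>
definition is_cycle :: "'v set set \<Rightarrow> 'v list \<Rightarrow> bool" where
  "is_cycle E c \<longleftrightarrow> 3 \<le> length c \<and> distinct c \<and>
     (\<forall>i < length c. {c ! i, c ! (Suc i mod length c)} \<in> E)"

definition vdegree :: "'v set set \<Rightarrow> 'v \<Rightarrow> nat" where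
  "vdegree E v = card {e \<in> E. v \<in> e}"

definition free_vertex :: "'v set set \<Rightarrow> 'v \<Rightarrow> bool" where
  "free_vertex E v \<longleftrightarrow> vdegree E v = 1"

definition is_leaf :: "'v set set \<Rightarrow> 'v set \<Rightarrow> bool" where
  "is_leaf E e \<longleftrightarrow> e \<in> E \<and> (\<exists>v\<in>e. free_vertex E v)"

definition is_branch :: "'v set set \<Rightarrow> 'v set \<Rightarrow> bool" where
  "is_branch E e \<longleftrightarrow> e \<in> E \<and> (\<exists>e'. is_leaf E e' \<and> e' \<noteq> e \<and> e \<inter> e' \<noteq> {})"


section \<open>Modules of homomorphisms, derivations and \<open>T\<^sup>1\<close>\<close>

definition ideal_module :: "('a, 'm) ring_scheme \<Rightarrow> 'a set \<Rightarrow> ('a, 'a) module" where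
  "ideal_module S I = \<lparr>carrier = I, mult = mult S, one = one S, zero = zero S, add = add S,
     smult = mult S\<rparr>"

definition quot_module :: "('a, 'm) ring_scheme \<Rightarrow> 'a set \<Rightarrow> ('a, 'a set) module" where
  "quot_module S I = ring.extend (S Quot I)
     \<lparr>smult = (\<lambda>s X. (I +>\<^bsub>S\<^esub> s) \<otimes>\<^bsub>S Quot I\<^esub> X)\<rparr>"

definition module_homs ::
    "('a, 'm) ring_scheme \<Rightarrow> ('a, 'b, 'p) module_scheme \<Rightarrow> ('a, 'c, 'q) module_scheme
      \<Rightarrow> ('b \<Rightarrow> 'c) set" where
  "module_homs S M N = {\<phi> \<in> carrier M \<rightarrow>\<^sub>E carrier N.
     (\<forall>x\<in>carrier M. \<forall>y\<in>carrier M. \<phi> (x \<oplus>\<^bsub>M\<^esub> y) = \<phi> x \<oplus>\<^bsub>N\<^esub> \<phi> y) \<and>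
     (\<forall>s\<in>carrier S. \<forall>x\<in>carrier M. \<phi> (s \<odot>\<^bsub>M\<^esub> x) = s \<odot>\<^bsub>N\<^esub> \<phi> x)}"

text \<open>The record type for modules extends the one for rings, so the fields \<open>mult\<close> and \<open>one\<close>
  have to be present; they play no role.\<close>
definition Hom_module ::
    "('a, 'm) ring_scheme \<Rightarrow> ('a, 'b, 'p) module_scheme \<Rightarrow> ('a, 'c, 'q) module_scheme
      \<Rightarrow> ('a, 'b \<Rightarrow> 'c) module" where
  "Hom_module S M N = \<lparr>carrier = module_homs S M N, mult = undefined, one = undefined,
     zero = (\<lambda>x\<in>carrier M. \<zero>\<^bsub>N\<^esub>),
     add = (\<lambda>\<phi> \<psi>. \<lambda>x\<in>carrier M. \<phi> x \<oplus>\<^bsub>N\<^esub> \<psi> x),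
     smult = (\<lambda>s \<phi>. \<lambda>x\<in>carrier M. s \<odot>\<^bsub>N\<^esub> \<phi> x)\<rparr>"

text \<open>\<open>K\<close> is a subring of \<open>S\<close>, the ring of scalars.\<close>
definition derivations :: "'a set \<Rightarrow> ('a, 'm) ring_scheme \<Rightarrow> ('a \<Rightarrow> 'a) set" where
  "derivations K S = {d \<in> carrier S \<rightarrow>\<^sub>E carrier S.
     (\<forall>f\<in>carrier S. \<forall>g\<in>carrier S. d (f \<oplus>\<^bsub>S\<^esub> g) = d f \<oplus>\<^bsub>S\<^esub> d g) \<and>
     (\<forall>c\<in>K. \<forall>f\<in>carrier S. d (c \<otimes>\<^bsub>S\<^esub> f) = c \<otimes>\<^bsub>S\<^esub> d f) \<and>
     (\<forall>f\<in>carrier S. \<forall>g\<in>carrier S.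
        d (f \<otimes>\<^bsub>S\<^esub> g) = (f \<otimes>\<^bsub>S\<^esub> d g) \<oplus>\<^bsub>S\<^esub> (g \<otimes>\<^bsub>S\<^esub> d f))}"

definition delta_star :: "('a, 'm) ring_scheme \<Rightarrow> 'a set \<Rightarrow> ('a \<Rightarrow> 'a) \<Rightarrow> ('a \<Rightarrow> 'a set)" where
  "delta_star S I d = (\<lambda>f\<in>I. I +>\<^bsub>S\<^esub> d f)"

text \<open>The additive group underlying the cokernel of
  \<open>\<delta>\<^sup>* : Der\<^sub>K(S) \<rightarrow> Hom\<^sub>S(I, S/I)\<close>.\<close>
definition T1 :: "'a set \<Rightarrow> ('a, 'm) ring_scheme \<Rightarrow> 'a set \<Rightarrow> ('a \<Rightarrow> 'a set) set monoid" where
  "T1 K S I = Hom_module S (ideal_module S I) (quot_module S I)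
     A_Mod (delta_star S I ` derivations K S)"


section \<open>Edge ideals\<close>

text \<open>A polynomial over \<open>'k\<close> maps exponent vectors \<open>nat \<Rightarrow>\<^sub>0 nat\<close> to coefficients; the
  multiplication of \<open>\<Rightarrow>\<^sub>0\<close> is convolution. \<open>poly_ring n\<close> is the ring of those polynomials in which
  only the variables with index in \<open>{1..n}\<close> occur.\<close>
type_synonym 'k mpoly = "(nat \<Rightarrow>\<^sub>0 nat) \<Rightarrow>\<^sub>0 'k"

definition poly_ring :: "nat \<Rightarrow> 'k::field mpoly ring" where
  "poly_ring n = \<lparr>carrier = {p. \<forall>m\<in>Poly_Mapping.keys p. Poly_Mapping.keys m \<subseteq> {1..n}},
     mult = (*), one = 1, zero = 0, add = (+)\<rparr>"

definition Const :: "'k::field \<Rightarrow> 'k mpoly" where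
  "Const c = Poly_Mapping.single 0 c"

definition Var :: "nat \<Rightarrow> 'k::field mpoly" where
  "Var i = Poly_Mapping.single (Poly_Mapping.single i 1) 1"

definition edge_ideal :: "nat \<Rightarrow> nat set set \<Rightarrow> 'k::field mpoly set" where
  "edge_ideal n E = Idl\<^bsub>poly_ring n\<^esub> {Var i * Var j | i j. {i, j} \<in> E}"

definition rigid :: "'k::field itself \<Rightarrow> nat \<Rightarrow> nat set set \<Rightarrow> bool" where
  "rigid _ n E \<longleftrightarrow>
     trivial_group (T1 (range Const) (poly_ring n :: 'k mpoly ring) (edge_ideal n E))"

end

theory Submission
  imports Defs
begin

text \<open>
  Two polynomials are congruent modulo \<open>I = I(G)\<close> iff they agree at all exponents with independent
  support, and a homomorphism \<open>I \<rightarrow> S/I\<close> is determined by the images \<open>f\<^sub>e\<close> of the edge monomials \<open>x\<^sub>e\<close>,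
  subject to \<open>x\<^sub>k f\<^bsub>ij\<^esub> = x\<^sub>j f\<^bsub>ik\<^esub>\<close> modulo \<open>I\<close>.

  If \<open>{i, j}\<close> is not a branch, every further neighbour \<open>k\<close> of \<open>i\<close> or \<open>j\<close> has a second neighbour
  \<open>k'\<close>. By the girth condition the \<open>k'\<close> are independent, so the product \<open>m\<close> of the \<open>x\<^bsub>k'\<^esub>\<close> is not in
  \<open>(x\<^sub>i, x\<^sub>j) + I\<close>, whereas \<open>x\<^sub>k m \<in> I\<close> for all \<open>k\<close>. Hence \<open>x\<^sub>i x\<^sub>j \<mapsto> m\<close>, \<open>x\<^sub>e \<mapsto> 0\<close> for the other
  edges, is a homomorphism which does not come from a derivation.

  Conversely, let all edges be branches. Comparing \<open>f\<^bsub>ij\<^esub>\<close> with \<open>f\<^bsub>ik\<^esub>\<close> for an adjacent leaf \<open>{i, k}\<close>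
  shows that every independent monomial of \<open>f\<^bsub>ij\<^esub>\<close> is divisible by \<open>x\<^sub>i\<close> or \<open>x\<^sub>j\<close>. As there are no
  triangles, the relations force the coefficient of \<open>w x\<^sub>j\<close> in \<open>f\<^bsub>ij\<^esub>\<close> not to depend on \<open>j\<close>; take it
  as the coefficient of \<open>w\<close> in \<open>g\<^sub>i\<close>. Then \<open>f\<^bsub>ij\<^esub> = g\<^sub>i x\<^sub>j + g\<^sub>j x\<^sub>i\<close>, so the homomorphism is induced by
  the derivation \<open>\<Sum>\<^sub>i g\<^sub>i \<partial>\<^sub>i\<close>.
\<close>

section \<open>The module of homomorphisms\<close>

text \<open>If \<open>H\<close> is the only right coset, then \<open>x = \<one> \<otimes> x\<close>
  lies in \<open>H #> x = H\<close> for every \<open>x\<close>. In this form, with just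
  \<open>\<one> \<in> H\<close>, the criterion applies directly to the image of
  \<open>delta_star\<close>.\<close>

lemma (in group) trivial_group_FactGroup_iff:
  assumes "H \<subseteq> carrier G" "\<one> \<in> H"
  shows "trivial_group (G Mod H) \<longleftrightarrow> H = carrier G"
proof
  assume "trivial_group (G Mod H)"
  then have cosets: "rcosets H = {H}"
    by (simp add: trivial_group_def FactGroup_def)
  show "H = carrier G"
  proof
    show "carrier G \<subseteq> H"
    proof
      fix x assume x: "x \<in> carrier G"
      then have "H #> x = H"
        using cosets rcosetsI[OF assms(1) x] by simp
      moreover have "x \<in> H #> x"
        using x assms(2) by (force simp: r_coset_def)
      ultimately show "x \<in> H" by simp
    qed
  qed (rule assms(1))
next
  assume H: "H = carrier G"
  interpret normal "carrier G" G
    by (simp add: normal_inv_iff subgroup_self)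
  have "rcosets (carrier G) = {carrier G}"
    using coset_join2[OF _ subgroup_self] one_closed unfolding RCOSETS_def by auto
  then show "trivial_group (G Mod H)"
    using factorgroup_is_group by (simp add: H trivial_group_def FactGroup_def)
qed

text \<open>The group laws hold pointwise, and extensional functions that agree on
  \<open>carrier M\<close> are equal. This is the additive group that \<open>T1\<close> divides by
  the image of \<open>delta_star\<close>.\<close>

lemma group_Hom_module:
  assumes "module S M" "module S N"
  shows "group (add_monoid (Hom_module S M N))"
proof -
  interpret M: module S M by fact
  interpret N: module S N by fact
  have ext: "f = g" if "f \<in> module_homs S M N" "g \<in> module_homs S M N"
      "\<And>x. x \<in> carrier M \<Longrightarrow> f x = g x" for f g
    using that unfolding module_homs_def by (auto intro: PiE_ext)
  have closed [simp]: "f x \<in> carrier N" if "f \<in> module_homs S M N" "x \<in> carrier M" for f x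
    using that unfolding module_homs_def by auto
  have add: "f (x \<oplus>\<^bsub>M\<^esub> y) = f x \<oplus>\<^bsub>N\<^esub> f y"
    if "f \<in> module_homs S M N" "x \<in> carrier M" "y \<in> carrier M" for f x y
    using that unfolding module_homs_def by auto
  have smult: "f (s \<odot>\<^bsub>M\<^esub> x) = s \<odot>\<^bsub>N\<^esub> f x"
    if "f \<in> module_homs S M N" "s \<in> carrier S" "x \<in> carrier M" for f s x
    using that unfolding module_homs_def by auto
  have plus: "(\<lambda>x\<in>carrier M. f x \<oplus>\<^bsub>N\<^esub> g x) \<in> module_homs S M N"
    if "f \<in> module_homs S M N" "g \<in> module_homs S M N" for f g
    by (subst module_homs_def) (auto simp: that add smult N.smult_r_distr N.a_ac)
  have zero: "(\<lambda>x\<in>carrier M. \<zero>\<^bsub>N\<^esub>) \<in> module_homs S M N"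
    unfolding module_homs_def by auto
  have minus: "(\<lambda>x\<in>carrier M. \<ominus>\<^bsub>N\<^esub> f x) \<in> module_homs S M N" if "f \<in> module_homs S M N" for f
    by (subst module_homs_def) (auto simp: that add smult N.smult_r_minus N.minus_add)
  show ?thesis
  proof (rule groupI, goal_cases)
    case (1 f g)
    then show ?case using plus by (simp add: Hom_module_def)
  next
    case 2
    then show ?case using zero by (simp add: Hom_module_def)
  next
    case (3 f g h)
    then show ?case
      by (auto simp: Hom_module_def fun_eq_iff N.a_assoc)
  next
    case (4 f)
    then show ?case
      using plus[OF zero, of f] by (intro ext) (auto simp: Hom_module_def)
  next
    case (5 f)
    show ?case
    proof (rule bexI)
      show "(\<lambda>x\<in>carrier M. \<ominus>\<^bsub>N\<^esub> f x) \<in> carrier (add_monoid (Hom_module S M N))"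
        using 5 minus by (simp add: Hom_module_def)
      show "(\<lambda>x\<in>carrier M. \<ominus>\<^bsub>N\<^esub> f x) \<otimes>\<^bsub>add_monoid (Hom_module S M N)\<^esub> f
            = \<one>\<^bsub>add_monoid (Hom_module S M N)\<^esub>"
        using 5 plus[OF minus, of f f] zero by (intro ext) (auto simp: Hom_module_def N.l_neg)
    qed
  qed
qed

section \<open>The ideal and the residue class ring as modules\<close>

lemma module_ideal_module:
  assumes "cring S" "ideal I S"
  shows "module S (ideal_module S I)"
proof -
  interpret cring S by fact
  interpret ideal I S by fact
  show ?thesis
    unfolding ideal_module_def
    by (intro moduleI abelian_groupI)
      (auto simp: I_l_closed l_distr r_distr m_assoc a_ac is_cring
        intro!: bexI[of _ "\<ominus>\<^bsub>S\<^esub> _"] r_neg)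
qed

lemma
  assumes "ideal I S"
  shows carrier_quot_module: "carrier (quot_module S I) = (+>\<^bsub>S\<^esub>) I ` carrier S"
    and zero_quot_module: "\<zero>\<^bsub>quot_module S I\<^esub> = I"
    and add_quot_module: "\<lbrakk>x \<in> carrier S; y \<in> carrier S\<rbrakk> \<Longrightarrow>
      (I +>\<^bsub>S\<^esub> x) \<oplus>\<^bsub>quot_module S I\<^esub> (I +>\<^bsub>S\<^esub> y) = I +>\<^bsub>S\<^esub> (x \<oplus>\<^bsub>S\<^esub> y)"
    and smult_quot_module: "\<lbrakk>s \<in> carrier S; x \<in> carrier S\<rbrakk> \<Longrightarrow>
      s \<odot>\<^bsub>quot_module S I\<^esub> (I +>\<^bsub>S\<^esub> x) = I +>\<^bsub>S\<^esub> (s \<otimes>\<^bsub>S\<^esub> x)"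
proof -
  interpret ideal I S by fact
  show "carrier (quot_module S I) = (+>\<^bsub>S\<^esub>) I ` carrier S"
    by (auto simp: quot_module_def FactRing_def ring.defs A_RCOSETS_def')
  show "\<zero>\<^bsub>quot_module S I\<^esub> = I"
    by (simp add: quot_module_def FactRing_def ring.defs)
  show "(I +>\<^bsub>S\<^esub> x) \<oplus>\<^bsub>quot_module S I\<^esub> (I +>\<^bsub>S\<^esub> y) = I +>\<^bsub>S\<^esub> (x \<oplus>\<^bsub>S\<^esub> y)"
    if "x \<in> carrier S" "y \<in> carrier S"
    using that by (simp add: quot_module_def FactRing_def ring.defs a_rcos_sum)
  show "s \<odot>\<^bsub>quot_module S I\<^esub> (I +>\<^bsub>S\<^esub> x) = I +>\<^bsub>S\<^esub> (s \<otimes>\<^bsub>S\<^esub> x)"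
    if "s \<in> carrier S" "x \<in> carrier S"
    using that by (simp add: quot_module_def FactRing_def ring.defs rcoset_mult_add)
qed

lemma module_quot_module:
  assumes "cring S" "ideal I S"
  shows "module S (quot_module S I)"
proof -
  interpret cring S by fact
  interpret ideal I S by fact
  note [simp] = carrier_quot_module[OF assms(2)] zero_quot_module[OF assms(2)]
    add_quot_module[OF assms(2)] smult_quot_module[OF assms(2)]
  \<comment> \<open>Writing the zero element \<open>I\<close> as the coset of zero brings it under
    the rules for computing with cosets.\<close>
  have I: "I = I +>\<^bsub>S\<^esub> \<zero>\<^bsub>S\<^esub>"
    by (simp add: a_subset)
  have add0: "I \<oplus>\<^bsub>quot_module S I\<^esub> (I +>\<^bsub>S\<^esub> x) = I +>\<^bsub>S\<^esub> x" if "x \<in> carrier S" for x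
    using add_quot_module[OF assms(2), of "\<zero>\<^bsub>S\<^esub>" x] that I by simp
  show ?thesis
  proof (intro moduleI abelian_groupI, goal_cases)
    case (6 X)
    then show ?case using add0 by auto
  next
    case (7 X)
    then obtain x where "x \<in> carrier S" "X = I +>\<^bsub>S\<^esub> x" by auto
    then show ?case using I by (intro bexI[of _ "I +>\<^bsub>S\<^esub> (\<ominus>\<^bsub>S\<^esub> x)"]) (auto simp: l_neg)
  qed (auto simp: l_distr r_distr m_assoc a_ac is_cring I[symmetric] add0
      intro: image_eqI[of _ _ "\<zero>\<^bsub>S\<^esub>"])
qed

text \<open>A homomorphism into \<open>S/I\<close> may be given by representatives; \<open>F\<close>
  has to be additive and linear only modulo \<open>I\<close>.\<close>

lemma module_homs_idealI:
  assumes "ideal I S"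
    and "\<And>f. f \<in> I \<Longrightarrow> F f \<in> carrier S"
    and "\<And>f g. \<lbrakk>f \<in> I; g \<in> I\<rbrakk> \<Longrightarrow> I +>\<^bsub>S\<^esub> F (f \<oplus>\<^bsub>S\<^esub> g) = I +>\<^bsub>S\<^esub> (F f \<oplus>\<^bsub>S\<^esub> F g)"
    and "\<And>s f. \<lbrakk>s \<in> carrier S; f \<in> I\<rbrakk> \<Longrightarrow> I +>\<^bsub>S\<^esub> F (s \<otimes>\<^bsub>S\<^esub> f) = I +>\<^bsub>S\<^esub> (s \<otimes>\<^bsub>S\<^esub> F f)"
  shows "(\<lambda>f\<in>I. I +>\<^bsub>S\<^esub> F f) \<in> module_homs S (ideal_module S I) (quot_module S I)"
proof -
  interpret ideal I S by fact
  show ?thesis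
    unfolding module_homs_def
    by (auto simp: ideal_module_def carrier_quot_module[OF assms(1)] add_quot_module[OF assms(1)]
        smult_quot_module[OF assms(1)] assms I_l_closed)
qed

text \<open>Conversely, choosing a representative in the coset \<open>\<phi> f\<close> for each
  \<open>f \<in> I\<close> brings every homomorphism into this form.\<close>

lemma module_homs_idealE:
  assumes "ideal I S" "\<phi> \<in> module_homs S (ideal_module S I) (quot_module S I)"
  obtains F where "\<phi> = (\<lambda>f\<in>I. I +>\<^bsub>S\<^esub> F f)"
    and "\<And>f. f \<in> I \<Longrightarrow> F f \<in> carrier S"
    and "\<And>f g. \<lbrakk>f \<in> I; g \<in> I\<rbrakk> \<Longrightarrow> I +>\<^bsub>S\<^esub> F (f \<oplus>\<^bsub>S\<^esub> g) = I +>\<^bsub>S\<^esub> (F f \<oplus>\<^bsub>S\<^esub> F g)"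
    and "\<And>s f. \<lbrakk>s \<in> carrier S; f \<in> I\<rbrakk> \<Longrightarrow> I +>\<^bsub>S\<^esub> F (s \<otimes>\<^bsub>S\<^esub> f) = I +>\<^bsub>S\<^esub> (s \<otimes>\<^bsub>S\<^esub> F f)"
proof -
  interpret ideal I S by fact
  have "\<exists>y\<in>carrier S. \<phi> f = I +>\<^bsub>S\<^esub> y" if "f \<in> I" for f
    using that assms(2)
    by (auto simp: module_homs_def ideal_module_def carrier_quot_module[OF assms(1)] PiE_iff image_iff)
  then obtain F where F: "\<And>f. f \<in> I \<Longrightarrow> F f \<in> carrier S" "\<And>f. f \<in> I \<Longrightarrow> \<phi> f = I +>\<^bsub>S\<^esub> F f"
    by metis
  show ?thesis
  proof (rule that[of F])
    show "\<phi> = (\<lambda>f\<in>I. I +>\<^bsub>S\<^esub> F f)"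
      using assms(2) F(2) by (auto simp: module_homs_def ideal_module_def PiE_iff extensional_def fun_eq_iff)
  next
    fix f g assume "f \<in> I" "g \<in> I"
    moreover from this have "\<phi> (f \<oplus>\<^bsub>S\<^esub> g) = \<phi> f \<oplus>\<^bsub>quot_module S I\<^esub> \<phi> g"
      using assms(2) by (simp add: module_homs_def ideal_module_def)
    ultimately show "I +>\<^bsub>S\<^esub> F (f \<oplus>\<^bsub>S\<^esub> g) = I +>\<^bsub>S\<^esub> (F f \<oplus>\<^bsub>S\<^esub> F g)"
      using F by (simp add: add_quot_module[OF assms(1)])
  next
    fix s f assume "s \<in> carrier S" "f \<in> I"
    moreover from this have "\<phi> (s \<otimes>\<^bsub>S\<^esub> f) = s \<odot>\<^bsub>quot_module S I\<^esub> \<phi> f"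
      using assms(2) by (simp add: module_homs_def ideal_module_def)
    ultimately show "I +>\<^bsub>S\<^esub> F (s \<otimes>\<^bsub>S\<^esub> f) = I +>\<^bsub>S\<^esub> (s \<otimes>\<^bsub>S\<^esub> F f)"
      using F I_l_closed by (simp add: smult_quot_module[OF assms(1)])
  qed (use F in auto)
qed

text \<open>A derivation is not linear over \<open>S\<close>, but the defect in
  \<open>d (s f) = s (d f) + f (d s)\<close> is a multiple of \<open>f\<close>, so it vanishes
  modulo \<open>I\<close> when \<open>f \<in> I\<close>.\<close>

lemma delta_star_in_module_homs:
  assumes "cring S" "ideal I S" "d \<in> derivations K S"
  shows "delta_star S I d \<in> module_homs S (ideal_module S I) (quot_module S I)"
proof -
  interpret cring S by fact
  interpret ideal I S by fact
  have d: "d f \<in> carrier S" if "f \<in> carrier S" for f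
    using assms(3) that by (auto simp: derivations_def)
  show ?thesis
    unfolding delta_star_def
  proof (rule module_homs_idealI[OF assms(2)])
    show "d f \<in> carrier S" if "f \<in> I" for f
      using that d by simp
    show "I +>\<^bsub>S\<^esub> d (f \<oplus>\<^bsub>S\<^esub> g) = I +>\<^bsub>S\<^esub> (d f \<oplus>\<^bsub>S\<^esub> d g)" if "f \<in> I" "g \<in> I" for f g
      using assms(3) that by (auto simp: derivations_def)
    show "I +>\<^bsub>S\<^esub> d (s \<otimes>\<^bsub>S\<^esub> f) = I +>\<^bsub>S\<^esub> (s \<otimes>\<^bsub>S\<^esub> d f)" if "s \<in> carrier S" "f \<in> I" for s f
    proof -
      have "d (s \<otimes>\<^bsub>S\<^esub> f) = (s \<otimes>\<^bsub>S\<^esub> d f) \<oplus>\<^bsub>S\<^esub> (f \<otimes>\<^bsub>S\<^esub> d s)"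
        using assms(3) that by (auto simp: derivations_def)
      moreover have "I +>\<^bsub>S\<^esub> (f \<otimes>\<^bsub>S\<^esub> d s) = I"
        using that d by (simp add: I_r_closed a_rcos_const)
      ultimately show ?thesis
        using that d a_rcos_sum[of "s \<otimes>\<^bsub>S\<^esub> d f" "f \<otimes>\<^bsub>S\<^esub> d s"]
          a_rcos_sum[of "s \<otimes>\<^bsub>S\<^esub> d f" "\<zero>\<^bsub>S\<^esub>"] by (simp add: a_subset)
    qed
  qed
qed

lemma trivial_T1_iff:
  assumes "cring S" "ideal I S" "K \<subseteq> carrier S"
  shows "trivial_group (T1 K S I) \<longleftrightarrow>
    delta_star S I ` derivations K S = module_homs S (ideal_module S I) (quot_module S I)"
proof -
  interpret cring S by fact
  interpret ideal I S by fact
  interpret hom: group "add_monoid (Hom_module S (ideal_module S I) (quot_module S I))"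
    using assms by (intro group_Hom_module module_ideal_module module_quot_module)
  \<comment> \<open>The zero derivation maps to the zero homomorphism, so the image contains the
    neutral element, as the coset criterion requires.\<close>
  have "(\<lambda>f\<in>carrier S. \<zero>\<^bsub>S\<^esub>) \<in> derivations K S"
    using assms(3) by (auto simp: derivations_def)
  moreover have "delta_star S I (\<lambda>f\<in>carrier S. \<zero>\<^bsub>S\<^esub>) = (\<lambda>f\<in>I. I)"
    by (auto simp: delta_star_def a_subset fun_eq_iff)
  ultimately have "(\<lambda>f\<in>I. I) \<in> delta_star S I ` derivations K S"
    by (metis imageI)
  moreover have "delta_star S I ` derivations K S
      \<subseteq> module_homs S (ideal_module S I) (quot_module S I)"
    using delta_star_in_module_homs[OF assms(1,2)] by auto
  ultimately show ?thesis
    unfolding T1_def A_FactGroup_def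
    by (subst hom.trivial_group_FactGroup_iff)
      (auto simp: Hom_module_def zero_quot_module[OF assms(2)] ideal_module_def)
qed


section \<open>Polynomials\<close>

abbreviation lookup :: "('a \<Rightarrow>\<^sub>0 'b::zero) \<Rightarrow> 'a \<Rightarrow> 'b"
  where "lookup \<equiv> Poly_Mapping.lookup"

abbreviation keys :: "('a \<Rightarrow>\<^sub>0 'b::zero) \<Rightarrow> 'a set"
  where "keys \<equiv> Poly_Mapping.keys"

abbreviation single :: "'a \<Rightarrow> 'b \<Rightarrow> 'a \<Rightarrow>\<^sub>0 'b::zero"
  where "single \<equiv> Poly_Mapping.single"

lemma poly_mapping_sum_single:
  fixes f :: "'a \<Rightarrow>\<^sub>0 'b::comm_monoid_add"
  shows "f = (\<Sum>u\<in>keys f. single u (lookup f u))"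
proof (rule poly_mapping_eqI)
  fix m
  have "lookup (\<Sum>u\<in>keys f. single u (lookup f u)) m = (\<Sum>u\<in>keys f. if u = m then lookup f u else 0)"
    by (simp add: lookup_sum lookup_single when_def)
  also have "\<dots> = lookup f m"
    by (simp add: sum.delta in_keys_iff)
  finally show "lookup f m = lookup (\<Sum>u\<in>keys f. single u (lookup f u)) m" ..
qed

text \<open>A polynomial is the sum of its terms. The case \<open>single\<close> concerns only the
  terms of \<open>f\<close> itself, so hypotheses on the support of \<open>f\<close> can be used
  there.\<close>

lemma poly_mapping_single_induct [case_names zero single add]:
  fixes f :: "'a \<Rightarrow>\<^sub>0 'b::comm_monoid_add"
  assumes "P 0"
    and "\<And>u. u \<in> keys f \<Longrightarrow> P (single u (lookup f u))"
    and "\<And>g h. P g \<Longrightarrow> P h \<Longrightarrow> P (g + h)"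
  shows "P f"
proof -
  have "P (\<Sum>u\<in>A. single u (lookup f u))" if "finite A" "A \<subseteq> keys f" for A
    using that by (induction A rule: finite_induct) (simp_all add: assms)
  then show ?thesis
    by (metis poly_mapping_sum_single finite_keys order_refl)
qed

text \<open>The linear map with value \<open>D u\<close> at the monomial with exponent
  \<open>u\<close>; the factor \<open>single 0 c\<close> is multiplication by the scalar
  \<open>c\<close>. It produces both the derivations and the homomorphism that obstructs
  rigidity.\<close>

definition lin_ext :: "('a::comm_monoid_add \<Rightarrow> ('a \<Rightarrow>\<^sub>0 'k::comm_ring_1)) \<Rightarrow> ('a \<Rightarrow>\<^sub>0 'k) \<Rightarrow> ('a \<Rightarrow>\<^sub>0 'k)"
  where "lin_ext D f = (\<Sum>u\<in>keys f. single 0 (lookup f u) * D u)"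

text \<open>Allows polynomials with different supports to be summed over a common index set.\<close>

lemma lin_ext_superset:
  assumes "finite A" "keys f \<subseteq> A"
  shows "lin_ext D f = (\<Sum>u\<in>A. single 0 (lookup f u) * D u)"
  unfolding lin_ext_def using assms
  by (intro sum.mono_neutral_left) (auto simp: in_keys_iff)

lemma lin_ext_zero [simp]: "lin_ext D 0 = 0"
  by (simp add: lin_ext_def)

lemma lin_ext_add: "lin_ext D (f + g) = lin_ext D f + lin_ext D g"
proof -
  let ?A = "keys f \<union> keys g"
  have "lin_ext D (f + g) = (\<Sum>u\<in>?A. single 0 (lookup (f + g) u) * D u)"
    by (rule lin_ext_superset) (simp_all add: keys_add)
  also have "\<dots> = (\<Sum>u\<in>?A. single 0 (lookup f u) * D u) + (\<Sum>u\<in>?A. single 0 (lookup g u) * D u)"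
    by (simp add: lookup_add single_add distrib_right sum.distrib)
  also have "\<dots> = lin_ext D f + lin_ext D g"
    by (simp add: lin_ext_superset[of ?A])
  finally show ?thesis .
qed

lemma lin_ext_single [simp]: "lin_ext D (single u c) = single 0 c * D u"
  by (simp add: lin_ext_superset[of "{u}"])

text \<open>Both sides are additive in \<open>f\<close> and in \<open>g\<close>, so the Leibniz rule
  has to be checked on pairs of terms only, where it follows from the rule for monomials.\<close>

lemma lin_ext_mult:
  assumes "\<And>u v. D (u + v) = single u 1 * D v + single v 1 * D u"
  shows "lin_ext D (f * g) = f * lin_ext D g + g * lin_ext D f"
proof (induction f rule: poly_mapping_single_induct)
  case (single u)
  show ?case
  proof (induction g rule: poly_mapping_single_induct)
    case (single v)
    let ?a = "lookup f u" and ?b = "lookup g v"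
    have *: "single w c = single 0 c * single w 1" for w :: 'a and c :: 'b
      by (simp add: mult_single)
    have "lin_ext D (single u ?a * single v ?b) =
        single 0 ?a * single 0 ?b * (single u 1 * D v + single v 1 * D u)"
      by (simp add: mult_single assms)
    also have "\<dots> = (single 0 ?a * single u 1) * (single 0 ?b * D v)
        + (single 0 ?b * single v 1) * (single 0 ?a * D u)"
      by (simp only: algebra_simps)
    finally show ?case
      by (simp only: lin_ext_single *[symmetric])
  qed (simp_all add: lin_ext_add distrib_left distrib_right)
qed (simp_all add: lin_ext_add distrib_left distrib_right)

text \<open>The value of the derivation \<Sum> g_i d/dx_i at the monomial with exponent
  \<open>u\<close>.\<close>

definition mono_deriv :: "('v \<Rightarrow> (('v \<Rightarrow>\<^sub>0 nat) \<Rightarrow>\<^sub>0 'k::comm_ring_1)) \<Rightarrow> ('v \<Rightarrow>\<^sub>0 nat) \<Rightarrow> (('v \<Rightarrow>\<^sub>0 nat) \<Rightarrow>\<^sub>0 'k)"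
  where "mono_deriv g u = (\<Sum>i\<in>keys u. single (u - single i 1) (of_nat (lookup u i)) * g i)"

lemma mono_deriv_superset:
  assumes "finite A" "keys u \<subseteq> A"
  shows "mono_deriv g u = (\<Sum>i\<in>A. single (u - single i 1) (of_nat (lookup u i)) * g i)"
  unfolding mono_deriv_def using assms
  by (intro sum.mono_neutral_left) (auto simp: in_keys_iff)

lemma add_single_diff:
  fixes u v :: "'v \<Rightarrow>\<^sub>0 nat"
  assumes "lookup v i \<noteq> 0"
  shows "u + v - single i 1 = u + (v - single i 1)"
  using assms by (intro poly_mapping_eqI) (auto simp: lookup_add lookup_minus lookup_single when_def)

text \<open>The coefficient u_i + v_i splits into two, and x_i is cancelled in the factor that
  supplies the exponent. Where truncated subtraction would be wrong, the coefficient is 0.\<close>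

lemma mono_deriv_add:
  "mono_deriv g (u + v) = single u 1 * mono_deriv g v + single v 1 * mono_deriv g u"
proof -
  let ?A = "keys u \<union> keys v"
  have *: "single (u + v - single i 1) (of_nat (lookup v i)) =
      single u (1::'b) * single (v - single i 1) (of_nat (lookup v i))" for u v :: "'a \<Rightarrow>\<^sub>0 nat" and i
    by (cases "lookup v i = 0")
      (simp_all only: mult_single add_single_diff mult_1 of_nat_0 single_zero
        mult_zero_right not_False_eq_True)
  have "single (u + v - single i 1) (of_nat (lookup (u + v) i)) * g i =
      single u 1 * (single (v - single i 1) (of_nat (lookup v i)) * g i) +
      single v 1 * (single (u - single i 1) (of_nat (lookup u i)) * g i)" for i
    using *[of v u i] *[of u v i]
    by (simp add: lookup_add single_add distrib_right mult.assoc add.commute)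
  then show ?thesis
    by (simp add: mono_deriv_superset[of ?A] keys_add sum.distrib sum_distrib_left)
qed

lemma mono_deriv_single: "mono_deriv g (single i 1) = g i"
  by (simp add: mono_deriv_superset[of "{i}"])

lemma lin_ext_mono_deriv_Const: "lin_ext (mono_deriv g) (Const c) = 0"
  by (simp add: Const_def mono_deriv_def)

section \<open>The polynomial ring and its derivations\<close>

lemma poly_ring_simps [simp]:
  "mult (poly_ring n) = (*)" "one (poly_ring n) = 1" "zero (poly_ring n) = 0"
  "add (poly_ring n) = (+)"
  by (simp_all add: poly_ring_def)

lemma in_carrier_poly_ring:
  "p \<in> carrier (poly_ring n) \<longleftrightarrow> (\<forall>m\<in>keys p. keys m \<subseteq> {1..n})"
  by (simp add: poly_ring_def)

lemma poly_ring_closed [simp]: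
  "0 \<in> carrier (poly_ring n)" "1 \<in> carrier (poly_ring n)" "Const c \<in> carrier (poly_ring n)"
  "p \<in> carrier (poly_ring n) \<Longrightarrow> q \<in> carrier (poly_ring n) \<Longrightarrow> p + q \<in> carrier (poly_ring n)"
  "p \<in> carrier (poly_ring n) \<Longrightarrow> - p \<in> carrier (poly_ring n)"
  "p \<in> carrier (poly_ring n) \<Longrightarrow> q \<in> carrier (poly_ring n) \<Longrightarrow> p * q \<in> carrier (poly_ring n)"
proof -
  show "p + q \<in> carrier (poly_ring n)" if "p \<in> carrier (poly_ring n)" "q \<in> carrier (poly_ring n)"
    using that keys_add[of p q] unfolding in_carrier_poly_ring by blast
  show "- p \<in> carrier (poly_ring n)" if "p \<in> carrier (poly_ring n)"
    using that by (simp add: in_carrier_poly_ring in_keys_iff)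
  show "p * q \<in> carrier (poly_ring n)" if "p \<in> carrier (poly_ring n)" "q \<in> carrier (poly_ring n)"
    unfolding in_carrier_poly_ring
  proof
    fix m assume "m \<in> keys (p * q)"
    then obtain u v where "m = u + v" "u \<in> keys p" "v \<in> keys q"
      using keys_mult[of p q] by blast
    then show "keys m \<subseteq> {1..n}"
      using that keys_add[of u v] unfolding in_carrier_poly_ring by blast
  qed
qed (auto simp: in_carrier_poly_ring Const_def in_keys_iff lookup_one lookup_single when_def)

lemma single_in_carrier: "keys u \<subseteq> {1..n} \<Longrightarrow> single u c \<in> carrier (poly_ring n)"
  by (simp add: in_carrier_poly_ring)

lemma Var_in_carrier [simp]: "i \<in> {1..n} \<Longrightarrow> Var i \<in> carrier (poly_ring n)"
  by (simp add: Var_def single_in_carrier)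

lemma sum_in_carrier:
  "(\<And>x. x \<in> A \<Longrightarrow> f x \<in> carrier (poly_ring n)) \<Longrightarrow> sum f A \<in> carrier (poly_ring n)"
  by (induction A rule: infinite_finite_induct) auto

lemma cring_poly_ring: "cring (poly_ring n)"
proof (intro cringI abelian_groupI comm_monoidI)
  fix x :: "'a mpoly" assume "x \<in> carrier (poly_ring n)"
  then show "\<exists>y\<in>carrier (poly_ring n). y \<oplus>\<^bsub>poly_ring n\<^esub> x = \<zero>\<^bsub>poly_ring n\<^esub>"
    by (intro bexI[of _ "- x"]) auto
qed (auto simp: algebra_simps)

lemma a_minus_poly_ring:
  assumes "f \<in> carrier (poly_ring n)" "g \<in> carrier (poly_ring n)"
  shows "f \<ominus>\<^bsub>poly_ring n\<^esub> g = f - g"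
proof -
  interpret cring "poly_ring n :: 'a mpoly ring" by (rule cring_poly_ring)
  have "\<ominus>\<^bsub>poly_ring n\<^esub> g = - g"
    using assms by (intro minus_equality) auto
  then show ?thesis by (simp add: a_minus_def)
qed

lemma lin_ext_in_carrier:
  assumes "\<And>u. u \<in> keys f \<Longrightarrow> D u \<in> carrier (poly_ring n)"
  shows "lin_ext D f \<in> carrier (poly_ring n)"
  unfolding lin_ext_def Const_def[symmetric] using assms by (intro sum_in_carrier) simp

lemma lin_ext_mono_deriv_in_carrier:
  assumes "\<And>i. g i \<in> carrier (poly_ring n)" "f \<in> carrier (poly_ring n)"
  shows "lin_ext (mono_deriv g) f \<in> carrier (poly_ring n)"
proof (rule lin_ext_in_carrier)
  fix u assume "u \<in> keys f"
  then have "keys u \<subseteq> {1..n}"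
    using assms(2) by (simp add: in_carrier_poly_ring)
  then have "keys (u - single i 1) \<subseteq> {1..n}" for i
    by (auto simp: in_keys_iff lookup_minus subset_iff)
  then show "mono_deriv g u \<in> carrier (poly_ring n)"
    unfolding mono_deriv_def using assms(1)
    by (intro sum_in_carrier poly_ring_closed single_in_carrier) auto
qed

text \<open>Arbitrary values \<open>g i\<close> at the variables extend to a derivation. Linearity
  over the constants follows from the Leibniz rule, since constants are sent to 0.\<close>

lemma mono_deriv_in_derivations:
  assumes "\<And>i. g i \<in> carrier (poly_ring n)"
  shows "(\<lambda>f\<in>carrier (poly_ring n). lin_ext (mono_deriv g) f)
    \<in> derivations (Set.range Const) (poly_ring n)"
  unfolding derivations_def
  by (auto simp: lin_ext_mono_deriv_in_carrier[OF assms] lin_ext_add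
      lin_ext_mult[OF mono_deriv_add] lin_ext_mono_deriv_Const)

lemma lin_ext_mono_deriv_Var: "lin_ext (mono_deriv g) (Var i) = g i"
  using mono_deriv_single[of g i] by (simp add: Var_def)

text \<open>Multiplication by a variable shifts exponents; the case distinction excludes truncated
  subtraction.\<close>

lemma lookup_single_mult:
  fixes m :: "'v \<Rightarrow>\<^sub>0 nat" and f :: "('v \<Rightarrow>\<^sub>0 nat) \<Rightarrow>\<^sub>0 'k::comm_ring_1"
  shows "lookup (single (single i 1) 1 * f) m
    = (if lookup m i = 0 then 0 else lookup f (m - single i 1))"
proof (induction f rule: poly_mapping_single_induct)
  case (single u)
  have "single i 1 + u = m \<longleftrightarrow> lookup m i \<noteq> 0 \<and> u = m - single i 1"
    by (auto simp: poly_mapping_eq_iff fun_eq_iff lookup_add lookup_minus lookup_single when_def)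
  then show ?case
    by (simp only: mult_single lookup_single when_def mult_1 split: if_split) auto
qed (auto simp: distrib_left lookup_add)

lemma lookup_Var_mult:
  "lookup (Var i * f) m = (if lookup m i = 0 then 0 else lookup f (m - single i 1))"
  unfolding Var_def by (rule lookup_single_mult)


section \<open>Edge ideals and independent exponents\<close>

text \<open>For a simple graph, the exponents in \<open>{1..n}\<close> with this property are those
  of the monomials outside the edge ideal, which form a basis of the residue class ring.\<close>

definition indep_exp :: "'v set set \<Rightarrow> ('v \<Rightarrow>\<^sub>0 nat) \<Rightarrow> bool"
  where "indep_exp E m \<longleftrightarrow> (\<forall>i j. {i, j} \<in> E \<longrightarrow> lookup m i = 0 \<or> lookup m j = 0)"

lemma edge_of_simple_graph:
  assumes "simple_graph {1..n} E" "{i, j} \<in> E"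
  shows "i \<in> {1..n}" "j \<in> {1..n}" "i \<noteq> j"
  using assms unfolding simple_graph_def by (auto simp: card_insert_if split: if_splits)

lemma indep_exp_mono:
  assumes "indep_exp E m" "keys u \<subseteq> keys m"
  shows "indep_exp E u"
  using assms unfolding indep_exp_def by (meson in_keys_iff subsetD)

text \<open>Divisors of independent monomials are independent: a term of \<open>s * f\<close> at an
  independent exponent would come from a term of \<open>f\<close> at an independent
  exponent.\<close>

lemma ideal_nonindep:
  "ideal {f \<in> carrier (poly_ring n). \<forall>m. indep_exp E m \<longrightarrow> lookup f m = (0::'k::field)} (poly_ring n)"
  (is "ideal ?J ?S")
proof -
  interpret cring ?S by (rule cring_poly_ring)
  have mult: "s * f \<in> ?J" if f: "f \<in> ?J" and s: "s \<in> carrier ?S" for s f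
  proof -
    have "lookup (s * f) m = 0" if m: "indep_exp E m" for m
    proof (rule ccontr)
      assume "lookup (s * f) m \<noteq> 0"
      then obtain u v where uv: "m = u + v" "v \<in> keys f"
        using keys_mult[of s f] by (auto simp: in_keys_iff)
      moreover have "keys v \<subseteq> keys (u + v)"
        by (auto simp: in_keys_iff lookup_add)
      ultimately have "indep_exp E v"
        using indep_exp_mono[OF m] by simp
      then show False using f uv by (auto simp: in_keys_iff)
    qed
    then show ?thesis using f s by simp
  qed
  show ?thesis
  proof (rule idealI)
    show "subgroup ?J (add_monoid ?S)"
    proof (rule add.subgroupI)
      fix f assume f: "f \<in> ?J"
      then have "\<ominus>\<^bsub>?S\<^esub> f = - f" by (intro minus_equality) auto
      then show "\<ominus>\<^bsub>?S\<^esub> f \<in> ?J" using f by simp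
    qed (auto simp: lookup_add intro!: exI[of _ 0])
  qed (use mult in \<open>auto simp: ring_axioms mult.commute\<close>)
qed

lemma edge_generators_in_carrier:
  assumes "simple_graph {1..n} E"
  shows "{Var i * Var j | i j. {i, j} \<in> E} \<subseteq> carrier (poly_ring n)"
  using edge_of_simple_graph[OF assms] by auto

lemma ideal_edge_ideal:
  assumes "simple_graph {1..n} E"
  shows "ideal (edge_ideal n E) (poly_ring n)"
proof -
  interpret cring "poly_ring n :: 'a mpoly ring" by (rule cring_poly_ring)
  show ?thesis
    unfolding edge_ideal_def by (rule genideal_ideal[OF edge_generators_in_carrier[OF assms]])
qed

lemma edge_generator_in_edge_ideal:
  assumes "simple_graph {1..n} E" "{i, j} \<in> E"
  shows "Var i * Var j \<in> edge_ideal n E"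
proof -
  interpret cring "poly_ring n :: 'a mpoly ring" by (rule cring_poly_ring)
  show ?thesis
    unfolding edge_ideal_def
    using genideal_self[OF edge_generators_in_carrier[OF assms(1)]] assms(2) by blast
qed

text \<open>A term whose exponent is not independent is divisible by \<open>Var i * Var j\<close>
  for some edge, so \<open>f\<close> is a sum of multiples of the generators.\<close>

lemma nonindep_induct [consumes 2, case_names zero generator add]:
  assumes "simple_graph {1..n} E"
    and "f \<in> {f \<in> carrier (poly_ring n). \<forall>m. indep_exp E m \<longrightarrow> lookup f m = 0}"
    and zero: "P 0"
    and generator: "\<And>s i j. \<lbrakk>s \<in> carrier (poly_ring n); {i, j} \<in> E\<rbrakk> \<Longrightarrow> P (s * (Var i * Var j))"
    and add: "\<And>g h. \<lbrakk>P g; P h\<rbrakk> \<Longrightarrow> P (g + h)"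
  shows "P f"
proof (induction f rule: poly_mapping_single_induct)
  case (single u)
  then have "\<not> indep_exp E u"
    using assms(2) by (auto simp: in_keys_iff)
  then obtain i j where ij: "{i, j} \<in> E" "lookup u i \<noteq> 0" "lookup u j \<noteq> 0"
    by (auto simp: indep_exp_def)
  let ?v = "u - single i 1 - single j 1"
  \<comment> \<open>Both subtractions are exact because \<open>i\<close> and \<open>j\<close> are
    distinct and occur in \<open>u\<close>.\<close>
  have "u = ?v + (single i 1 + single j 1)"
    using ij edge_of_simple_graph[OF assms(1) ij(1)]
    by (intro poly_mapping_eqI) (auto simp: lookup_add lookup_minus lookup_single when_def)
  then have "single u (lookup f u) = single ?v (lookup f u) * (Var i * Var j)"
    unfolding Var_def mult_single by simp
  moreover have "keys u \<subseteq> {1..n}"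
    using assms(2) single by (auto simp: in_carrier_poly_ring)
  then have "keys ?v \<subseteq> {1..n}"
    by (auto simp: in_keys_iff lookup_minus subset_iff)
  ultimately show ?case
    using generator[OF single_in_carrier ij(1)] by simp
qed (use zero add in auto)

text \<open>The right-hand side is an ideal containing the generators, and by
  \<open>nonindep_induct\<close> each of its elements is a combination of them. Membership thus
  becomes a condition on coefficients.\<close>

lemma edge_ideal_eq:
  assumes "simple_graph {1..n} E"
  shows "edge_ideal n E = {f \<in> carrier (poly_ring n). \<forall>m. indep_exp E m \<longrightarrow> lookup f m = (0::'k::field)}"
    (is "?I = ?J")
proof
  let ?S = "poly_ring n :: 'k mpoly ring"
  interpret cring ?S by (rule cring_poly_ring)
  interpret I: ideal ?I ?S by (rule ideal_edge_ideal[OF assms])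
  have "Var i * Var j \<in> ?J" if "{i, j} \<in> E" for i j
  proof -
    have "lookup (Var i * Var j) m = (0::'k)" if "indep_exp E m" for m
    proof -
      have "lookup m i = 0 \<or> lookup m j = 0"
        using that \<open>{i, j} \<in> E\<close> by (auto simp: indep_exp_def)
      then show ?thesis
        by (auto simp: Var_def mult_single lookup_single when_def lookup_add)
    qed
    then show ?thesis
      using edge_of_simple_graph[OF assms that] by simp
  qed
  then show "?I \<subseteq> ?J"
    unfolding edge_ideal_def by (intro genideal_minimal ideal_nonindep) auto
  show "?J \<subseteq> ?I"
  proof
    fix f assume "f \<in> ?J"
    with assms show "f \<in> ?I"
    proof (induction f rule: nonindep_induct)
      case zero
      show ?case using I.zero_closed by simp
    next
      case (generator s i j)
      then show ?case
        using I.I_l_closed[OF edge_generator_in_edge_ideal[OF assms]] by simp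
    next
      case (add g h)
      then show ?case using I.a_closed[of g h] by simp
    qed
  qed
qed

lemma coset_edge_ideal_eq_iff:
  assumes "simple_graph {1..n} E" "f \<in> carrier (poly_ring n)" "g \<in> carrier (poly_ring n)"
  shows "edge_ideal n E +>\<^bsub>poly_ring n\<^esub> f = edge_ideal n E +>\<^bsub>poly_ring n\<^esub> g \<longleftrightarrow>
    (\<forall>m. indep_exp E m \<longrightarrow> lookup f m = lookup (g :: 'k::field mpoly) m)"
proof -
  interpret cring "poly_ring n :: 'k mpoly ring" by (rule cring_poly_ring)
  have "f - g \<in> carrier (poly_ring n)"
    using poly_ring_closed(4)[OF assms(2) poly_ring_closed(5)[OF assms(3)]] by simp
  then show ?thesis
    using quotient_eq_iff_same_a_r_cos[OF ideal_edge_ideal[OF assms(1)] assms(2,3), symmetric]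
    by (simp add: a_minus_poly_ring assms(2,3) edge_ideal_eq[OF assms(1)] lookup_minus)
qed


section \<open>Rigidity in terms of representatives\<close>

lemma module_homs_edge_ideal_eqI:
  fixes n :: nat and E :: "nat set set" and \<phi> \<psi> :: "'k::field mpoly \<Rightarrow> 'k mpoly set"
  defines "S \<equiv> poly_ring n :: 'k mpoly ring" and "I \<equiv> edge_ideal n E :: 'k mpoly set"
  assumes E: "simple_graph {1..n} E"
    and hom: "\<phi> \<in> module_homs S (ideal_module S I) (quot_module S I)"
      "\<psi> \<in> module_homs S (ideal_module S I) (quot_module S I)"
    and eq: "\<And>i j. {i, j} \<in> E \<Longrightarrow> \<phi> (Var i * Var j) = \<psi> (Var i * Var j)"
  shows "\<phi> = \<psi>"
proof -
  interpret I: ideal I S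
    unfolding S_def I_def by (rule ideal_edge_ideal[OF E])
  interpret N: module S "quot_module S I"
    unfolding S_def I_def by (intro module_quot_module cring_poly_ring ideal_edge_ideal E)
  have zero_I: "0 \<in> I"
    using additive_subgroup.zero_closed[OF I.is_additive_subgroup] by (simp add: S_def)
  have hom_zero: "\<phi> 0 = \<zero>\<^bsub>quot_module S I\<^esub>"
    if "\<phi> \<in> module_homs S (ideal_module S I) (quot_module S I)" for \<phi>
  proof -
    have "\<phi> 0 \<in> carrier (quot_module S I)"
      using that zero_I by (auto simp: module_homs_def ideal_module_def)
    moreover have "\<forall>s\<in>carrier S. \<forall>x\<in>I. \<phi> (s * x) = s \<odot>\<^bsub>quot_module S I\<^esub> \<phi> x"
      using that by (simp add: module_homs_def ideal_module_def S_def)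
    then have "\<phi> (0 * 0) = 0 \<odot>\<^bsub>quot_module S I\<^esub> \<phi> 0"
      using zero_I by (simp only: S_def poly_ring_closed(1) Ball_def)
    ultimately show ?thesis using N.smult_l_null by (simp add: S_def)
  qed
  \<comment> \<open>Membership in \<open>I\<close> is carried through the induction because
    additivity of \<open>\<phi>\<close> and \<open>\<psi>\<close> is available only for summands in
    \<open>I\<close>.\<close>
  have "f \<in> I \<and> \<phi> f = \<psi> f" if "f \<in> I" for f
  proof -
    from E that[unfolded I_def edge_ideal_eq[OF E]] show ?thesis
    proof (induction f rule: nonindep_induct)
      case zero
      show ?case by (simp add: zero_I hom_zero hom)
    next
      case (generator s i j)
      moreover have "Var i * Var j \<in> I"
        unfolding I_def by (rule edge_generator_in_edge_ideal[OF E generator(2)])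
      moreover from this have "s * (Var i * Var j) \<in> I"
        using I.I_l_closed generator(1) by (simp add: S_def)
      ultimately show ?case
        using hom eq by (simp add: module_homs_def ideal_module_def S_def)
    next
      case (add g h)
      then show ?case
        using hom additive_subgroup.a_closed[OF I.is_additive_subgroup, of g h]
        by (simp add: module_homs_def ideal_module_def S_def)
    qed
  qed
  then show ?thesis
    using hom by (auto simp: module_homs_def ideal_module_def intro: PiE_ext)
qed

text \<open>Homomorphisms \<open>I(G) \<rightarrow> S/I(G)\<close> in terms of representatives, with congruence modulo \<open>I(G)\<close>
  expressed by coefficients at independent exponents.\<close>
definition hom_rep :: "nat \<Rightarrow> nat set set \<Rightarrow> ('k::field mpoly \<Rightarrow> 'k mpoly) \<Rightarrow> bool"
  where "hom_rep n E F \<longleftrightarrow>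
    (\<forall>f\<in>edge_ideal n E. F f \<in> carrier (poly_ring n)) \<and>
    (\<forall>f\<in>edge_ideal n E. \<forall>g\<in>edge_ideal n E. \<forall>m. indep_exp E m \<longrightarrow>
       lookup (F (f + g)) m = lookup (F f + F g) m) \<and>
    (\<forall>s\<in>carrier (poly_ring n). \<forall>f\<in>edge_ideal n E. \<forall>m. indep_exp E m \<longrightarrow>
       lookup (F (s * f)) m = lookup (s * F f) m)"

text \<open>If a derivation induces the homomorphism, its values at the variables serve as
  \<open>g\<close> by the Leibniz rule. Conversely, \<open>g\<close> defines a derivation whose
  homomorphism agrees with the given one on the generators, hence everywhere.\<close>

lemma rigid_iff:
  assumes E: "simple_graph {1..n} E"
  shows "rigid TYPE('k::field) n E \<longleftrightarrow>
    (\<forall>F :: 'k mpoly \<Rightarrow> 'k mpoly. hom_rep n E F \<longrightarrow>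
      (\<exists>g. (\<forall>i. g i \<in> carrier (poly_ring n)) \<and>
        (\<forall>i j m. {i, j} \<in> E \<longrightarrow> indep_exp E m \<longrightarrow>
          lookup (F (Var i * Var j)) m = lookup (Var i * g j + Var j * g i) m)))"
    (is "_ \<longleftrightarrow> ?R")
proof -
  let ?S = "poly_ring n :: 'k mpoly ring" and ?I = "edge_ideal n E :: 'k mpoly set"
  let ?H = "module_homs ?S (ideal_module ?S ?I) (quot_module ?S ?I)"
  let ?K = "Set.range Const :: 'k mpoly set"
  note I = ideal_edge_ideal[OF E] and S = cring_poly_ring
  note coset_eq = coset_edge_ideal_eq_iff[OF E]
  interpret ideal ?I ?S by (rule I)
  have gen: "Var i * Var j \<in> ?I" if "{i, j} \<in> E" for i j
    by (rule edge_generator_in_edge_ideal[OF E that])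
  have Icl: "s * f \<in> ?I" "f + g \<in> ?I" if "f \<in> ?I" "g \<in> ?I" "s \<in> carrier ?S" for f g s
    using that I_l_closed[of f s] additive_subgroup.a_closed[OF is_additive_subgroup, of f g] by auto
  have carr: "f \<in> carrier ?S" if "f \<in> ?I" for f
    using that by (rule a_Hcarr)
  have "rigid TYPE('k) n E \<longleftrightarrow> delta_star ?S ?I ` derivations ?K ?S = ?H"
    unfolding rigid_def by (rule trivial_T1_iff[OF S I]) auto
  also have "\<dots> \<longleftrightarrow> ?H \<subseteq> delta_star ?S ?I ` derivations ?K ?S"
    using delta_star_in_module_homs[OF S I] by blast
  also have "\<dots> \<longleftrightarrow> ?R"
  proof (intro iffI allI impI subsetI)
    fix F :: "'k mpoly \<Rightarrow> 'k mpoly"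
    assume onto: "?H \<subseteq> delta_star ?S ?I ` derivations ?K ?S" and F: "hom_rep n E F"
    have "(\<lambda>f\<in>?I. ?I +>\<^bsub>?S\<^esub> F f) \<in> ?H"
    proof (rule module_homs_idealI[OF I])
      show "?I +>\<^bsub>?S\<^esub> F (f \<oplus>\<^bsub>?S\<^esub> g) = ?I +>\<^bsub>?S\<^esub> (F f \<oplus>\<^bsub>?S\<^esub> F g)" if "f \<in> ?I" "g \<in> ?I" for f g
        using F that Icl[OF that poly_ring_closed(1)] unfolding hom_rep_def
        by (auto simp: coset_eq)
      show "?I +>\<^bsub>?S\<^esub> F (s \<otimes>\<^bsub>?S\<^esub> f) = ?I +>\<^bsub>?S\<^esub> (s \<otimes>\<^bsub>?S\<^esub> F f)"
        if "s \<in> carrier ?S" "f \<in> ?I" for s f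
        using F that Icl[OF that(2,2,1)] unfolding hom_rep_def
        by (auto simp: coset_eq)
    qed (use F in \<open>simp add: hom_rep_def\<close>)
    then obtain d where d: "d \<in> derivations ?K ?S"
      and eq: "(\<lambda>f\<in>?I. ?I +>\<^bsub>?S\<^esub> F f) = delta_star ?S ?I d"
      using onto by blast
    \<comment> \<open>The default 0 keeps \<open>g i\<close> in the ring for indices outside
      \<open>{1..n}\<close>, which are on no edge.\<close>
    define g where "g i = (if i \<in> {1..n} then d (Var i) else 0)" for i
    have d_carr: "d f \<in> carrier ?S" if "f \<in> carrier ?S" for f
      using that d by (auto simp: derivations_def)
    show "\<exists>g. (\<forall>i. g i \<in> carrier ?S) \<and>
        (\<forall>i j m. {i, j} \<in> E \<longrightarrow> indep_exp E m \<longrightarrow>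
          lookup (F (Var i * Var j)) m = lookup (Var i * g j + Var j * g i) m)"
    proof (intro exI[of _ g] conjI allI impI)
      show "g i \<in> carrier ?S" for i
        by (simp add: g_def d_carr)
      fix i j m assume ij: "{i, j} \<in> E" and m: "indep_exp E m"
      note ij' = edge_of_simple_graph[OF E ij]
      have "d (Var i * Var j) = Var i * g j + Var j * g i"
        using d ij' by (auto simp: derivations_def g_def)
      moreover from this have "Var i * g j + Var j * g i \<in> carrier ?S"
        using d_carr[OF carr[OF gen[OF ij]]] by simp
      moreover have "?I +>\<^bsub>?S\<^esub> F (Var i * Var j) = ?I +>\<^bsub>?S\<^esub> d (Var i * Var j)"
        using fun_cong[OF eq, of "Var i * Var j"] gen[OF ij] by (simp add: delta_star_def)
      ultimately show "lookup (F (Var i * Var j)) m = lookup (Var i * g j + Var j * g i) m"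
        using F gen[OF ij] m coset_eq[of "F (Var i * Var j)" "d (Var i * Var j)"] carr d_carr
        unfolding hom_rep_def by auto
    qed
  next
    fix \<phi> assume R: ?R and \<phi>: "\<phi> \<in> ?H"
    from I \<phi> obtain F where F: "\<phi> = (\<lambda>f\<in>?I. ?I +>\<^bsub>?S\<^esub> F f)"
      "\<And>f. f \<in> ?I \<Longrightarrow> F f \<in> carrier ?S"
      "\<And>f g. \<lbrakk>f \<in> ?I; g \<in> ?I\<rbrakk> \<Longrightarrow> ?I +>\<^bsub>?S\<^esub> F (f \<oplus>\<^bsub>?S\<^esub> g) = ?I +>\<^bsub>?S\<^esub> (F f \<oplus>\<^bsub>?S\<^esub> F g)"
      "\<And>s f. \<lbrakk>s \<in> carrier ?S; f \<in> ?I\<rbrakk> \<Longrightarrow> ?I +>\<^bsub>?S\<^esub> F (s \<otimes>\<^bsub>?S\<^esub> f) = ?I +>\<^bsub>?S\<^esub> (s \<otimes>\<^bsub>?S\<^esub> F f)"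
      by (rule module_homs_idealE) blast
    have "hom_rep n E F"
      unfolding hom_rep_def
    proof (intro conjI ballI allI impI)
      fix f g m assume "f \<in> ?I" "g \<in> ?I" "indep_exp E m"
      then show "lookup (F (f + g)) m = lookup (F f + F g) m"
        using F(3)[of f g] F(2) Icl[of f g 0] coset_eq[of "F (f + g)" "F f + F g"] by auto
    next
      fix s f m assume "s \<in> carrier ?S" "f \<in> ?I" "indep_exp E m"
      then show "lookup (F (s * f)) m = lookup (s * F f) m"
        using F(4)[of s f] F(2) Icl[of f f s] coset_eq[of "F (s * f)" "s * F f"] by auto
    qed (rule F(2))
    then obtain g where g: "\<And>i. g i \<in> carrier ?S"
      "\<And>i j m. \<lbrakk>{i, j} \<in> E; indep_exp E m\<rbrakk> \<Longrightarrow>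
        lookup (F (Var i * Var j)) m = lookup (Var i * g j + Var j * g i) m"
      using R by blast
    let ?d = "\<lambda>f\<in>carrier ?S. lin_ext (mono_deriv g) f"
    have d: "?d \<in> derivations ?K ?S"
      by (rule mono_deriv_in_derivations[OF g(1)])
    have "\<phi> = delta_star ?S ?I ?d"
    proof (rule module_homs_edge_ideal_eqI[OF E \<phi> delta_star_in_module_homs[OF S I d]])
      fix i j assume ij: "{i, j} \<in> E"
      note ij' = edge_of_simple_graph[OF E ij]
      have carr': "Var i * g j + Var j * g i \<in> carrier ?S"
        using g(1) ij' by simp
      have "?d (Var i * Var j) = Var i * g j + Var j * g i"
        using ij' by (simp add: lin_ext_mult[OF mono_deriv_add] lin_ext_mono_deriv_Var)
      then show "\<phi> (Var i * Var j) = delta_star ?S ?I ?d (Var i * Var j)"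
        using gen[OF ij] g(2)[OF ij] coset_eq[OF F(2)[OF gen[OF ij]] carr']
        by (simp add: F(1) delta_star_def)
    qed
    then show "\<phi> \<in> delta_star ?S ?I ` derivations ?K ?S"
      using d by blast
  qed
  finally show ?thesis .
qed


section \<open>Short cycles\<close>

context
  fixes n :: nat and E :: "nat set set"
  assumes graph: "simple_graph {1..n} E"
    and girth: "\<forall>c. is_cycle E c \<longrightarrow> 7 \<le> length c"
begin

lemma no_3_cycle:
  assumes "{a, b} \<in> E" "{b, c} \<in> E" "{c, a} \<in> E"
  shows False
proof -
  have "is_cycle E [a, b, c]"
    unfolding is_cycle_def using assms assms[THEN edge_of_simple_graph(3)[OF graph]]
    by (simp add: All_less_Suc)
  then show False using girth by fastforce
qed

lemma no_4_cycle:
  assumes "{a, b} \<in> E" "{b, c} \<in> E" "{c, d} \<in> E" "{d, a} \<in> E" "a \<noteq> c" "b \<noteq> d"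
  shows False
proof -
  have "is_cycle E [a, b, c, d]"
    unfolding is_cycle_def using assms assms(1-4)[THEN edge_of_simple_graph(3)[OF graph]]
    by (simp add: All_less_Suc)
  then show False using girth by fastforce
qed

text \<open>Two equal non-consecutive vertices of a closed walk of length 5 would leave a triangle,
  so all five are distinct.\<close>

lemma no_5_cycle:
  assumes "{a, b} \<in> E" "{b, c} \<in> E" "{c, d} \<in> E" "{d, e} \<in> E" "{e, a} \<in> E"
  shows False
proof -
  have "a \<noteq> c" "a \<noteq> d" "b \<noteq> d" "b \<noteq> e" "c \<noteq> e"
    using assms no_3_cycle[of c d e] no_3_cycle[of a b c] no_3_cycle[of d e a]
      no_3_cycle[of b c d] no_3_cycle[of e a b] by blast+
  then have "is_cycle E [a, b, c, d, e]"
    unfolding is_cycle_def using assms assms[THEN edge_of_simple_graph(3)[OF graph]]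
    by (simp add: All_less_Suc)
  then show False using girth by fastforce
qed

text \<open>Vertices two steps apart are distinct by assumption; equal opposite vertices would split
  the walk into two triangles.\<close>

lemma no_6_cycle:
  assumes "{a, b} \<in> E" "{b, c} \<in> E" "{c, d} \<in> E" "{d, e} \<in> E" "{e, f} \<in> E" "{f, a} \<in> E"
    and "a \<noteq> c" "b \<noteq> d" "c \<noteq> e" "d \<noteq> f" "e \<noteq> a" "f \<noteq> b"
  shows False
proof -
  have "a \<noteq> d" "b \<noteq> e" "c \<noteq> f"
    using assms no_3_cycle[of a b c] no_3_cycle[of b c d] no_3_cycle[of c d e] by blast+
  then have "is_cycle E [a, b, c, d, e, f]"
    unfolding is_cycle_def using assms assms(1-6)[THEN edge_of_simple_graph(3)[OF graph]]
    by (simp add: All_less_Suc)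
  then show False using girth by fastforce
qed

text \<open>Otherwise \<open>k\<close> would be free, and the leaf \<open>{i, k}\<close> would make
  \<open>{i, j}\<close> a branch.\<close>

lemma other_neighbour:
  assumes "{i, j} \<in> E" "\<not> is_branch E {i, j}" "{i, k} \<in> E" "k \<noteq> j"
  obtains l where "{k, l} \<in> E" "l \<noteq> i"
proof -
  have "\<not> is_leaf E {i, k}"
    using assms edge_of_simple_graph(3)[OF graph]
    by (auto simp: is_branch_def doubleton_eq_iff)
  then have "card {e \<in> E. k \<in> e} \<noteq> 1"
    using assms(3) by (auto simp: is_leaf_def free_vertex_def vdegree_def)
  moreover have "{i, k} \<in> {e \<in> E. k \<in> e}"
    using assms(3) by simp
  ultimately obtain e where e: "e \<in> E" "k \<in> e" "e \<noteq> {i, k}"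
    using is_singletonI'[of "{e \<in> E. k \<in> e}"] unfolding is_singleton_altdef
    by (metis (mono_tags, lifting) empty_iff mem_Collect_eq)
  then have "card e = 2"
    using graph by (simp add: simple_graph_def)
  with e(2) obtain l where "e = {k, l}"
    by (auto simp: card_2_iff)
  then show thesis
    using e that[of l] by (auto simp: insert_commute)
qed

text \<open>The second neighbours chosen below are pairwise nonadjacent: an edge between two of them would
  close a cycle of length at most 6 through \<open>{i, j}\<close>.\<close>
lemma not_branch_separating_set:
  assumes ij: "{i, j} \<in> E" and nb: "\<not> is_branch E {i, j}"
  obtains T where "T \<subseteq> {1..n}" "i \<notin> T" "j \<notin> T"
    and "\<And>a b. \<lbrakk>a \<in> T; b \<in> T\<rbrakk> \<Longrightarrow> {a, b} \<notin> E"
    and "\<And>p k. \<lbrakk>p \<in> {i, j}; {p, k} \<in> E; k \<notin> {i, j}\<rbrakk> \<Longrightarrow> \<exists>l\<in>T. {k, l} \<in> E"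
proof -
  note edge_sym = insert_commute[of _ _ "{}"]
  define B where "B = {k. k \<notin> {i, j} \<and> (\<exists>p\<in>{i, j}. {p, k} \<in> E)}"
  \<comment> \<open>The second neighbour differs from the end \<open>p\<close> adjacent to
    \<open>k\<close>; were it the other end \<open>q\<close>, then \<open>p\<close>,
    \<open>k\<close>, \<open>q\<close> would form a triangle.\<close>
  have "\<exists>l. {k, l} \<in> E \<and> l \<notin> {i, j}" if "k \<in> B" for k
  proof -
    obtain p q where pq: "{p, q} = {i, j}" "p \<noteq> q" "{p, k} \<in> E" "k \<notin> {i, j}"
      using \<open>k \<in> B\<close> edge_of_simple_graph(3)[OF graph ij] unfolding B_def by auto
    then have "{p, q} \<in> E" "\<not> is_branch E {p, q}" "k \<noteq> q"
      using ij nb by auto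
    then obtain l where l: "{k, l} \<in> E" "l \<noteq> p"
      using other_neighbour pq(3) by blast
    moreover have "l \<noteq> q"
      using no_3_cycle[of p k q] l pq \<open>{p, q} \<in> E\<close> by (auto simp: edge_sym)
    ultimately show ?thesis using pq(1) by (metis doubleton_eq_iff insert_iff singletonD)
  qed
  then obtain c where c: "\<And>k. k \<in> B \<Longrightarrow> {k, c k} \<in> E" "\<And>k. k \<in> B \<Longrightarrow> c k \<notin> {i, j}"
    by metis
  have nonadj: "{c k, c l} \<notin> E" if kl: "k \<in> B" "l \<in> B" for k l
  proof
    assume adj: "{c k, c l} \<in> E"
    obtain p q where p: "p \<in> {i, j}" "{p, k} \<in> E" and q: "q \<in> {i, j}" "{q, l} \<in> E"
      using kl unfolding B_def by blast
    have ck: "{k, c k} \<in> E" "{c l, l} \<in> E" using c(1) kl by (auto simp: edge_sym)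
    show False
    proof (cases "p = q")
      case True
      then show False
        using no_5_cycle[of p k "c k" "c l" l] p q adj ck by (auto simp: edge_sym)
    next
      case False
      then have pq: "{q, p} \<in> E" using p q ij by (auto simp: edge_sym)
      have k: "k \<notin> {p, q}" "l \<notin> {p, q}" "c k \<notin> {p, q}" "c l \<notin> {p, q}"
        using kl c(2) p(1) q(1) unfolding B_def by auto
      have lq: "{l, q} \<in> E" "{k, p} \<in> E" "{l, k} \<in> E \<Longrightarrow> {k, l} \<in> E"
        using q p by (auto simp: edge_sym)
      \<comment> \<open>An edge here would close the 4-cycle \<open>p\<close>, \<open>k\<close>,
        \<open>l\<close>, \<open>q\<close>. Hence \<open>c k \<noteq> l\<close> and
        \<open>c l \<noteq> k\<close>, as is needed to exclude the 6-cycle \<open>p\<close>,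
        \<open>k\<close>, \<open>c k\<close>, \<open>c l\<close>, \<open>l\<close>,
        \<open>q\<close>.\<close>
      have "{k, l} \<notin> E"
        using no_4_cycle[of p k l q] p(2) lq(1) pq k by auto
      then have "c k \<noteq> l" "c l \<noteq> k"
        using ck by (auto simp: edge_sym)
      then show False
        using no_6_cycle[of p k "c k" "c l" l q] p(2) ck adj lq pq k by auto
    qed
  qed
  show thesis
  proof (rule that[of "c ` B"])
    show "c ` B \<subseteq> {1..n}"
      using c(1) edge_of_simple_graph(2)[OF graph] by blast
    show "\<exists>l\<in>c ` B. {k, l} \<in> E" if "p \<in> {i, j}" "{p, k} \<in> E" "k \<notin> {i, j}" for p k
      using that c(1)[of k] unfolding B_def by blast
  qed (use c(2) nonadj in auto)
qed

end


section \<open>Edges that are not branches\<close>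

lemma not_branch_imp_not_rigid:
  assumes graph: "simple_graph {1..n} E"
    and girth: "\<forall>c. is_cycle E c \<longrightarrow> 7 \<le> length c"
    and ij: "{i, j} \<in> E" and nb: "\<not> is_branch E {i, j}"
  shows "\<not> rigid TYPE('k::field) n E"
proof
  assume rigid: "rigid TYPE('k) n E"
  have neq: "i \<noteq> j"
    using edge_of_simple_graph(3)[OF graph ij] .
  obtain T where T: "T \<subseteq> {1..n}" "i \<notin> T" "j \<notin> T"
      "\<And>a b. \<lbrakk>a \<in> T; b \<in> T\<rbrakk> \<Longrightarrow> {a, b} \<notin> E"
      "\<And>p k. \<lbrakk>p \<in> {i, j}; {p, k} \<in> E; k \<notin> {i, j}\<rbrakk> \<Longrightarrow> \<exists>l\<in>T. {k, l} \<in> E"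
    using not_branch_separating_set[OF graph girth ij nb] by blast
  have "finite T" using T(1) finite_subset by blast
  define M :: "nat \<Rightarrow>\<^sub>0 nat" where "M = (\<Sum>l\<in>T. single l 1)"
  have M: "lookup M l = (if l \<in> T then 1 else 0)" for l
    using \<open>finite T\<close> by (simp add: M_def lookup_sum lookup_single when_def sum.delta)
  have indep_M: "indep_exp E M"
    using T(4) by (auto simp: indep_exp_def M)
  \<comment> \<open>\<open>P\<close> divides a monomial by x_i x_j and multiplies it by the product
    of the variables in \<open>T\<close>; monomials not divisible by x_i x_j go to 0. On the edge
    ideal this is linear modulo the ideal.\<close>
  define sh where "sh u = u - single i 1 - single j 1 + M" for u :: "nat \<Rightarrow>\<^sub>0 nat"
  define P :: "(nat \<Rightarrow>\<^sub>0 nat) \<Rightarrow> 'k mpoly"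
    where "P u = (if lookup u i \<noteq> 0 \<and> lookup u j \<noteq> 0 then single (sh u) 1 else 0)" for u
  have sh_add: "sh (v + u) = v + sh u" if "lookup u i \<noteq> 0" "lookup u j \<noteq> 0" for u v
    using that neq unfolding sh_def
    by (intro poly_mapping_eqI) (auto simp: lookup_add lookup_minus lookup_single when_def)
  have P_single: "lookup (single 0 c * P (v + u)) m = lookup (single v c * P u) m"
    if u: "\<not> indep_exp E u" and m: "indep_exp E m" for u v m c
  proof (cases "lookup u i \<noteq> 0 \<and> lookup u j \<noteq> 0")
    case True
    then show ?thesis
      by (simp add: P_def sh_add mult_single lookup_add)
  next
    case False
    \<comment> \<open>Here \<open>P u = 0\<close>, but x_i x_j may divide the multiple, so its image
      must be shown to lie in the ideal. An edge in the support of \<open>u\<close> has an end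
      outside \<open>{i, j}\<close>, which survives the shift. The other end survives too, or it is
      \<open>i\<close> or \<open>j\<close> and the first end has a neighbour in
      \<open>T\<close>.\<close>
    obtain p q where pq: "{p, q} \<in> E" "lookup u p \<noteq> 0" "lookup u q \<noteq> 0"
      using u by (auto simp: indep_exp_def)
    have "\<not> indep_exp E (sh (v + u))"
    proof -
      have pos: "lookup (sh (v + u)) k \<noteq> 0" if "k \<notin> {i, j}" "lookup u k \<noteq> 0" for k
        using that by (simp add: sh_def lookup_add lookup_minus lookup_single when_def)
      have *: "\<not> indep_exp E (sh (v + u))"
        if "{p, q} \<in> E" "lookup u q \<noteq> 0" "p \<in> {i, j}" "q \<notin> {i, j}" for p q
      proof -
        obtain l where "l \<in> T" "{q, l} \<in> E"
          using T(5) \<open>{p, q} \<in> E\<close> \<open>p \<in> {i, j}\<close> \<open>q \<notin> {i, j}\<close> by blast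
        moreover have "lookup (sh (v + u)) l \<noteq> 0" if "l \<in> T" for l
          using that by (simp add: sh_def lookup_add M)
        ultimately show ?thesis
          using pos that unfolding indep_exp_def by blast
      qed
      have "p \<notin> {i, j} \<or> q \<notin> {i, j}"
        using False pq edge_of_simple_graph(3)[OF graph pq(1)] by auto
      then consider "p \<notin> {i, j}" "q \<notin> {i, j}" | "p \<in> {i, j}" "q \<notin> {i, j}" | "q \<in> {i, j}" "p \<notin> {i, j}"
        by blast
      then show ?thesis
      proof cases
        case 1
        then show ?thesis using pos pq unfolding indep_exp_def by blast
      next
        case 2
        then show ?thesis using * pq by blast
      next
        case 3
        then show ?thesis using *[of q p] pq by (simp add: insert_commute)
      qed
    qed
    then have "sh (v + u) \<noteq> m" using m by auto
    then show ?thesis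
      using False by (auto simp: P_def mult_single lookup_single when_def)
  qed
  have "hom_rep n E (lin_ext P)"
    unfolding hom_rep_def edge_ideal_eq[OF graph]
  proof (intro conjI ballI allI impI)
    fix f assume f: "f \<in> {f \<in> carrier (poly_ring n). \<forall>m. indep_exp E m \<longrightarrow> lookup f m = (0::'k)}"
    show "lin_ext P f \<in> carrier (poly_ring n)"
    proof (rule lin_ext_in_carrier)
      fix u assume "u \<in> keys f"
      then have "keys u \<subseteq> {1..n}"
        using f by (simp add: in_carrier_poly_ring)
      then have "keys (sh u) \<subseteq> {1..n}"
        using T(1) by (auto simp: sh_def in_keys_iff lookup_add lookup_minus M subset_iff split: if_splits)
      then show "P u \<in> carrier (poly_ring n)"
        by (simp add: P_def single_in_carrier)
    qed
    fix s :: "'k mpoly" and m assume m: "indep_exp E m"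
    show "lookup (lin_ext P (s * f)) m = lookup (s * lin_ext P f) m"
    proof (induction f rule: poly_mapping_single_induct)
      case (single u)
      then have u: "\<not> indep_exp E u"
        using f by (auto simp: in_keys_iff)
      show ?case
      proof (induction s rule: poly_mapping_single_induct)
        case (single v)
        show ?case
          using P_single[OF u m, of "lookup s v * lookup f u" v]
          by (simp add: mult_single mult.assoc[symmetric])
      qed (simp_all add: lin_ext_add distrib_right lookup_add)
    qed (simp_all add: lin_ext_add distrib_left lookup_add)
  qed (simp add: lin_ext_add)
  \<comment> \<open>At the exponent \<open>M\<close> the image of x_i x_j has coefficient 1, while
    multiples of x_i and x_j have coefficient 0 there.\<close>
  then obtain g where "lookup (lin_ext P (Var i * Var j)) M = lookup (Var i * g j + Var j * g i) M"
    using rigid ij indep_M unfolding rigid_iff[OF graph] by blast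
  also have "\<dots> = 0"
    using T(2,3) by (simp add: lookup_add lookup_Var_mult M)
  finally show False
    by (simp add: Var_def mult_single P_def sh_def lookup_add lookup_single)
qed


section \<open>Graphs all of whose edges are branches\<close>

text \<open>The free vertex \<open>k\<close> of the adjacent leaf is not in \<open>e\<close>,
  because its only edge is that leaf. So the leaf joins \<open>k\<close> to the common vertex, which
  is named \<open>i\<close>.\<close>

lemma is_branchE:
  assumes graph: "simple_graph {1..n} E" and "is_branch E e"
  obtains i j k where "e = {i, j}" "{i, k} \<in> E" "k \<noteq> j" "\<And>l. {k, l} \<in> E \<Longrightarrow> l = i"
proof -
  obtain e' v where e: "e \<in> E" "e' \<in> E" "e' \<noteq> e" "e \<inter> e' \<noteq> {}"
    and v: "v \<in> e'" "card {e \<in> E. v \<in> e} = 1"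
    using assms(2) by (auto simp: is_branch_def is_leaf_def free_vertex_def vdegree_def)
  obtain c where c: "{e \<in> E. v \<in> e} = {c}"
    using v(2) by (rule card_1_singletonE)
  have v_only: "d = e'" if "d \<in> E" "v \<in> d" for d
  proof -
    have "d \<in> {e \<in> E. v \<in> e}" "e' \<in> {e \<in> E. v \<in> e}"
      using that v(1) e(2) by simp_all
    then show ?thesis unfolding c by simp
  qed
  have "v \<notin> e"
    using v_only e by blast
  obtain i where i: "i \<in> e" "i \<in> e'" using e(4) by blast
  have "card e = 2" "card e' = 2"
    using e graph by (auto simp: simple_graph_def)
  then obtain j where j: "e = {i, j}"
    using i by (auto simp: card_2_iff)
  have e': "e' = {i, v}"
    using \<open>card e' = 2\<close> i v \<open>v \<notin> e\<close> by (auto simp: card_2_iff)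
  show thesis
  proof (rule that[OF j])
    show "{i, v} \<in> E" using e e' by simp
    show "v \<noteq> j" using \<open>v \<notin> e\<close> j by auto
    show "l = i" if "{v, l} \<in> E" for l
      using v_only[OF that] edge_of_simple_graph(3)[OF graph that] by (auto simp: e' doubleton_eq_iff)
  qed
qed

lemma branches_imp_rigid:
  assumes graph: "simple_graph {1..n} E"
    and girth: "\<forall>c. is_cycle E c \<longrightarrow> 7 \<le> length c"
    and branch: "\<forall>e\<in>E. is_branch E e"
  shows "rigid TYPE('k::field) n E"
  unfolding rigid_iff[OF graph]
proof (intro allI impI)
  fix F :: "'k mpoly \<Rightarrow> 'k mpoly" assume F: "hom_rep n E F"
  define f where "f i j = F (Var i * Var j)" for i j
  have f_commute: "f i j = f j i" for i j
    by (simp add: f_def mult.commute)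
  have gen: "Var i * Var j \<in> (edge_ideal n E :: 'k mpoly set)" if "{i, j} \<in> E" for i j
    by (rule edge_generator_in_edge_ideal[OF graph that])
  have f_carr: "f i j \<in> carrier (poly_ring n)" if "{i, j} \<in> E" for i j
    using F gen[OF that] by (simp add: hom_rep_def f_def)
  \<comment> \<open>Both sides represent the image of x_i x_j x_k.\<close>
  have syzygy: "lookup (Var k * f i j) m = lookup (Var j * f i k) m"
    if ij: "{i, j} \<in> E" and ik: "{i, k} \<in> E" and m: "indep_exp E m" for i j k m
  proof -
    have "lookup (F (Var k * (Var i * Var j))) m = lookup (Var k * f i j) m"
      using F m gen[OF ij] edge_of_simple_graph[OF graph ik]
      by (simp add: hom_rep_def f_def)
    moreover have "lookup (F (Var j * (Var i * Var k))) m = lookup (Var j * f i k) m"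
      using F m gen[OF ik] edge_of_simple_graph[OF graph ij]
      by (simp add: hom_rep_def f_def)
    moreover have "Var k * (Var i * Var j) = Var j * (Var i * Var k :: 'k mpoly)"
      by (simp add: algebra_simps)
    ultimately show ?thesis by simp
  qed
  have vanish: "lookup (f i j) m = 0"
    if ij: "{i, j} \<in> E" and m: "indep_exp E m" and 0: "lookup m i = 0" "lookup m j = 0" for i j m
  proof -
    obtain p q k where e: "{i, j} = {p, q}" and k: "{p, k} \<in> E" "k \<noteq> q" "\<And>l. {k, l} \<in> E \<Longrightarrow> l = p"
      using is_branchE[OF graph branch[rule_format, OF ij]] by blast
    have pq: "lookup m p = 0" "lookup m q = 0" "{p, q} \<in> E" "f i j = f p q"
      using e ij 0 f_commute[of p q] by (auto simp: doubleton_eq_iff insert_commute)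
    \<comment> \<open>Adding \<open>k\<close> preserves independence, since its only neighbour
      \<open>p\<close> is absent from \<open>m\<close>. At \<open>?m\<close>, multiplication by x_k
      recovers the coefficient of \<open>f p q\<close> at \<open>m\<close>, and a multiple of x_q
      has coefficient 0.\<close>
    let ?m = "m + single k 1"
    have "k \<noteq> p" using edge_of_simple_graph(3)[OF graph k(1)] by simp
    have "indep_exp E ?m"
      unfolding indep_exp_def
    proof (intro allI impI)
      fix a b assume ab: "{a, b} \<in> E"
      then have "{b, a} \<in> E" by (simp add: insert_commute)
      then show "lookup ?m a = 0 \<or> lookup ?m b = 0"
        using m ab k(3) pq(1) \<open>k \<noteq> p\<close>
        by (auto simp: indep_exp_def lookup_add lookup_single when_def)
    qed
    from syzygy[OF pq(3) k(1) this] show ?thesis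
      using pq k(2) by (simp add: lookup_Var_mult lookup_add lookup_single when_def)
  qed
  have consistent: "lookup (f i j) (w + single j 1) = lookup (f i k) (w + single k 1)"
    if ij: "{i, j} \<in> E" and ik: "{i, k} \<in> E"
      and indep: "indep_exp E (w + single j 1)" "indep_exp E (w + single k 1)" for i j k w
  proof (cases "j = k")
    case False
    \<comment> \<open>Without triangles \<open>j\<close> and \<open>k\<close> are not adjacent, so
      \<open>w\<close> times x_j x_k is still independent, and the syzygy at this exponent compares
      the two coefficients.\<close>
    have jk: "{j, k} \<notin> E"
      using no_3_cycle[OF graph girth ij, of k] ik by (auto simp: insert_commute)
    have jk_indep: "indep_exp E (w + single j 1 + single k 1)"
      unfolding indep_exp_def
    proof (intro allI impI)
      fix a b assume ab: "{a, b} \<in> E"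
      then have "\<not> (a = j \<and> b = k)" "\<not> (a = k \<and> b = j)"
        using jk by (auto simp: insert_commute)
      moreover have "lookup (w + single j 1) a = 0 \<or> lookup (w + single j 1) b = 0"
        "lookup (w + single k 1) a = 0 \<or> lookup (w + single k 1) b = 0"
        using indep ab by (simp_all add: indep_exp_def)
      ultimately show "lookup (w + single j 1 + single k 1) a = 0 \<or> lookup (w + single j 1 + single k 1) b = 0"
        by (auto simp: lookup_add lookup_single when_def split: if_splits)
    qed
    have "w + single j 1 + single k 1 - single j 1 = w + single k 1"
      by (metis add.assoc add.commute add_diff_cancel_right')
    then show ?thesis
      using syzygy[OF ij ik jk_indep] False
      by (simp add: lookup_Var_mult lookup_add)
  qed simp
  have "\<exists>g \<in> carrier (poly_ring n). \<forall>j w. {i, j} \<in> E \<longrightarrow> indep_exp E (w + single j 1) \<longrightarrow>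
      lookup g w = lookup (f i j) (w + single j 1)" for i
  proof -
    define Q where "Q w j \<longleftrightarrow> {i, j} \<in> E \<and> indep_exp E (w + single j 1)" for w j
    \<comment> \<open>By \<open>consistent\<close> the value does not depend on the chosen
      \<open>j\<close>. If no \<open>j\<close> is admissible, \<open>w\<close> gets coefficient
      0.\<close>
    define G where "G w = (if \<exists>j. Q w j
        then lookup (f i (SOME j. Q w j)) (w + single (SOME j. Q w j) 1) else 0)" for w
    have G: "G w = lookup (f i j) (w + single j 1)" if "Q w j" for w j
    proof -
      define j' where "j' = (SOME j. Q w j)"
      have "Q w j'" unfolding j'_def using that by (rule someI)
      moreover have "G w = lookup (f i j') (w + single j' 1)"
        unfolding G_def j'_def using that by (simp only: if_P[OF exI])
      ultimately show ?thesis
        using consistent[of i j' j w] that unfolding Q_def by (simp only:)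
    qed
    have G_nz: "\<exists>j. {i, j} \<in> E \<and> w + single j 1 \<in> keys (f i j)" if "G w \<noteq> 0" for w
    proof -
      have "\<exists>j. Q w j"
        using \<open>G w \<noteq> 0\<close> unfolding G_def by presburger
      then obtain j where "Q w j" ..
      then show ?thesis using G that unfolding Q_def by (auto simp: in_keys_iff)
    qed
    \<comment> \<open>Finite support makes \<open>G\<close> a polynomial: an exponent with nonzero
      value arises from a term of one of the finitely many \<open>f i j\<close> by cancelling
      x_j.\<close>
    have "{w. G w \<noteq> 0} \<subseteq> (\<Union>j\<in>{1..n}. (\<lambda>m. m - single j 1) ` keys (f i j))"
    proof
      fix w assume "w \<in> {w. G w \<noteq> 0}"
      then obtain j where "{i, j} \<in> E" "w + single j 1 \<in> keys (f i j)"
        using G_nz by auto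
      moreover from this have "j \<in> {1..n}" using edge_of_simple_graph[OF graph] by blast
      ultimately show "w \<in> (\<Union>j\<in>{1..n}. (\<lambda>m. m - single j 1) ` keys (f i j))"
        by (intro UN_I[of j] image_eqI[of _ _ "w + single j 1"]) auto
    qed
    then have "finite {w. G w \<noteq> 0}"
      by (rule finite_subset) auto
    then have lookup_G: "lookup (Abs_poly_mapping G) = G"
      by simp
    show ?thesis
    proof (intro bexI[of _ "Abs_poly_mapping G"] allI impI)
      show "Abs_poly_mapping G \<in> carrier (poly_ring n)"
        unfolding in_carrier_poly_ring
      proof
        fix w assume "w \<in> keys (Abs_poly_mapping G)"
        then obtain j where j: "{i, j} \<in> E" "w + single j 1 \<in> keys (f i j)"
          using G_nz by (auto simp: in_keys_iff lookup_G)
        have "keys w \<subseteq> keys (w + single j 1)"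
          by (auto simp: in_keys_iff lookup_add)
        also have "\<dots> \<subseteq> {1..n}"
          using f_carr[OF j(1)] j(2) unfolding in_carrier_poly_ring by blast
        finally show "keys w \<subseteq> {1..n}" .
      qed
    qed (simp add: lookup_G G Q_def)
  qed
  then obtain g where g_carr: "\<And>i. g i \<in> carrier (poly_ring n)"
    and g: "\<And>i j w. \<lbrakk>{i, j} \<in> E; indep_exp E (w + single j 1)\<rbrakk> \<Longrightarrow>
      lookup (g i) w = lookup (f i j) (w + single j 1)"
    by metis
  show "\<exists>g. (\<forall>i. g i \<in> carrier (poly_ring n)) \<and>
      (\<forall>i j m. {i, j} \<in> E \<longrightarrow> indep_exp E m \<longrightarrow>
        lookup (F (Var i * Var j)) m = lookup (Var i * g j + Var j * g i) m)"
  proof (intro exI[of _ g] conjI allI impI g_carr)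
    fix i j m assume ij: "{i, j} \<in> E" and m: "indep_exp E m"
    have ji: "{j, i} \<in> E" using ij by (simp add: insert_commute)
    have sub: "m - single k 1 + single k 1 = m" if "lookup m k \<noteq> 0" for k
      using that by (intro poly_mapping_eqI) (auto simp: lookup_add lookup_minus lookup_single when_def)
    have g': "lookup (g a) (m - single b 1) = lookup (f a b) m" if "{a, b} \<in> E" "lookup m b \<noteq> 0" for a b
      using g[of a b "m - single b 1"] that m sub[of b] by simp
    have "lookup m i = 0 \<or> lookup m j = 0"
      using m ij by (simp add: indep_exp_def)
    \<comment> \<open>If neither variable divides the monomial, all coefficients vanish; if exactly
      one does, only the summand with that factor contributes, and \<open>g'\<close> evaluates
      it.\<close>
    then consider "lookup m i = 0" "lookup m j = 0" | "lookup m i = 0" "lookup m j \<noteq> 0"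
      | "lookup m i \<noteq> 0" "lookup m j = 0"
      by argo
    then have "lookup (f i j) m = lookup (Var i * g j + Var j * g i) m"
    proof cases
      case 1
      then show ?thesis using vanish[OF ij m] by (simp add: lookup_add lookup_Var_mult)
    next
      case 2
      then show ?thesis using g'[OF ij] by (simp add: lookup_add lookup_Var_mult)
    next
      case 3
      then show ?thesis using g'[OF ji] by (simp add: lookup_add lookup_Var_mult f_commute[of j i])
    qed
    then show "lookup (F (Var i * Var j)) m = lookup (Var i * g j + Var j * g i) m"
      by (simp add: f_def)
  qed
qed

theorem corollary3p12:
  fixes n :: nat and E :: "nat set set"
  assumes "simple_graph {1..n} E"
    and "\<forall>c. is_cycle E c \<longrightarrow> 7 \<le> length c"
  shows "rigid TYPE('k::field) n E \<longleftrightarrow> (\<forall>e\<in>E. is_branch E e)"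
proof
  assume rigid: "rigid TYPE('k) n E"
  show "\<forall>e\<in>E. is_branch E e"
  proof (rule ballI, rule ccontr)
    fix e assume e: "e \<in> E" "\<not> is_branch E e"
    then obtain i j where "e = {i, j}"
      using assms(1) by (auto simp: simple_graph_def card_2_iff)
    then show False
      using not_branch_imp_not_rigid[OF assms] e rigid by blast
  qed
next
  assume "\<forall>e\<in>E. is_branch E e"
  then show "rigid TYPE('k) n E"
    by (rule branches_imp_rigid[OF assms])
qed

end
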